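(* Let $1<p<\infty$ and let $Q_0$ be a cube in $\mathbb{R}^n$. Then $\bar{\mathcal{L}}^{p,n}(Q_0)=\bar{\mathcal{L}}^{1,n}(Q_0)$ with equivalence of the corresponding norms, i.e. the two classes coincide and there is a constant $C\ge1$ such that $C^{-1}\|f\|_{\bar{\mathcal{L}}^{1,n}(Q_0)}\le\|f\|_{\bar{\mathcal{L}}^{p,n}(Q_0)}\le C\|f\|_{\bar{\mathcal{L}}^{1,n}(Q_0)}$ for all $f$ in the class.
   Context: Cubes have sides parallel to the coordinate axes; $Q(x,\rho)$ is the cube with center $x$ and side length $2\rho$, and $Q_0(x_0,\rho):=Q(x_0,\rho)\cap Q_0$. For a set $E$ of positive finite measure, $|f|_E:=\frac{1}{|E|}\int_E|f(y)|\,dy$. For $0<p<\infty$, the class $\bar{\mathcal{L}}^{p,n}(Q_0)$ consists of the functions $f\in L^1(Q_0)$ with $$\|f\|_{\bar{\mathcal{L}}^{p,n}(Q_0)}^p:=\sup_{x_0\in Q_0,\rho>0}\rho^{-n}\int_{Q_0(x_0,\rho)}\big|f(x)-|f|_{Q_0(x_0,\rho)}\big|^p\,dx<\infty.$$ *)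

theory Defs
  imports "HOL-Analysis.Analysis"
begin

(* Cubes are taken closed; the side length is 2 * rho. *)
definition cube :: "real ^ 'n \<Rightarrow> real \<Rightarrow> (real ^ 'n) set" where
  "cube x \<rho> = {y. \<forall>i. \<bar>y $ i - x $ i\<bar> \<le> \<rho>}"

definition is_cube :: "(real ^ 'n) set \<Rightarrow> bool" where
  "is_cube Q \<longleftrightarrow> (\<exists>x \<rho>. 0 < \<rho> \<and> Q = cube x \<rho>)"

definition mean_abs :: "(real ^ 'n) set \<Rightarrow> (real ^ 'n \<Rightarrow> real) \<Rightarrow> real" where
  "mean_abs E f = (1 / measure lebesgue E) * (LINT y:E|lebesgue. \<bar>f y\<bar>)"

(* The p-th power of the norm, with values in [0, \<infinity>].  The extended nonnegative
   integral is used so that a divergent integral counts as \<infinity>, not as 0. *)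
definition barL_sup :: "real \<Rightarrow> (real ^ 'n) set \<Rightarrow> (real ^ 'n \<Rightarrow> real) \<Rightarrow> ennreal" where
  "barL_sup p Q\<^sub>0 f =
     (SUP x\<^sub>0\<in>Q\<^sub>0. SUP \<rho>\<in>{0<..}.
        ennreal (1 / \<rho> ^ CARD('n)) *
        (\<integral>\<^sup>+x\<in>cube x\<^sub>0 \<rho> \<inter> Q\<^sub>0.
            ennreal (\<bar>f x - mean_abs (cube x\<^sub>0 \<rho> \<inter> Q\<^sub>0) f\<bar> powr p) \<partial>lebesgue))"

definition barL :: "real \<Rightarrow> (real ^ 'n) set \<Rightarrow> (real ^ 'n \<Rightarrow> real) set" where
  "barL p Q\<^sub>0 = {f. f absolutely_integrable_on Q\<^sub>0 \<and> barL_sup p Q\<^sub>0 f < \<infinity>}"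

(* Meaningful only for members of barL p: enn2real sends \<infinity> to 0. *)
definition barL_norm :: "real \<Rightarrow> (real ^ 'n) set \<Rightarrow> (real ^ 'n \<Rightarrow> real) \<Rightarrow> real" where
  "barL_norm p Q\<^sub>0 f = enn2real (barL_sup p Q\<^sub>0 f) powr (1 / p)"

end

theory Submission
  imports Defs
begin

text \<open>The oscillation of \<open>f\<close> on a truncated cube \<open>R\<close> is measured from the mean of \<open>\<bar>f\<bar>\<close>, which is nonnegative.
For \<open>c \<ge> 0\<close> one has \<open>\<bar>\<bar>t\<bar> - c\<bar> \<le> \<bar>t - c\<bar>\<close>, so the mean of \<open>\<bar>f\<bar>\<close> on a subset \<open>E\<close> deviates from \<open>c\<close> by at most
the average of \<open>\<bar>f - c\<bar>\<close> over \<open>E\<close> (\<open>mean_abs_deviation_le\<close>). This is the one fact about means that the proof of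
the John-Nirenberg inequality needs, and therefore that proof goes through for these
oscillations of \<open>f\<close> about the mean of \<open>\<bar>f\<bar>\<close>.

Only the \<open>L\<^sup>p\<close> form of the inequality is required, and it follows from a self-improving estimate
rather than from exponential decay. Suppose that on all boxes of bounded eccentricity the mean oscillation is at most
\<open>K\<close>, and that the \<open>p\<close>-th power of the oscillation truncated at height \<open>N\<close> has mean at most \<open>B\<close>. A
Calderon-Zygmund decomposition at a height \<open>l\<close>, a large multiple of \<open>K\<close>, confines the part of the
oscillation exceeding \<open>l\<close> to disjoint dyadic cells occupying a small fraction of the box
(\<open>calderon_zygmund_decomposition\<close>). On each cell the mean has moved by at most a multiple of \<open>l\<close> and the bound \<open>B\<close> applies
again, so the mean in question is at most \<open>B / 2\<close> plus a multiple of \<open>K powr p\<close>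
(\<open>truncated_oscillation_improve\<close>). Iterating from the trivial bound \<open>B = N powr p\<close> removes the dependence on \<open>N\<close>
(\<open>oscillation_Lp_bound\<close>).

Truncated cubes are boxes whose sides have lengths between some \<open>\<sigma>\<close> and \<open>2 * \<sigma>\<close>, and conversely
the oscillation on every such box inside the cube is controlled by that on a truncated cube of
comparable size (\<open>cube_Int_fat_box\<close>, \<open>fat_box_oscillation_le\<close>). The reverse bound, of the \<open>L\<^sup>1\<close> oscillation by
the \<open>L\<^sup>p\<close> oscillation, is elementary (\<open>barL_sup_1_le\<close>).\<close>

section \<open>Half-open boxes and their dyadic cells\<close>

text \<open>Half-open boxes of side vector \<open>s\<close> are used, since the dyadic pieces of such a box are genuinely
disjoint; a closed box differs from its half-open version by a null set.\<close>

definition hbox :: "real ^ 'n \<Rightarrow> real ^ 'n \<Rightarrow> (real ^ 'n) set" where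
  "hbox c s = {y. \<forall>i. c $ i \<le> y $ i \<and> y $ i < c $ i + s $ i}"

lemma hbox_sets [measurable]: "hbox c s \<in> sets borel"
  unfolding hbox_def by measurable

lemma hbox_lebesgue [measurable]: "hbox c s \<in> sets lebesgue"
  using hbox_sets[of c s] by simp

lemma box_hbox_cbox: "box c (c + s) \<subseteq> hbox c s" "hbox c s \<subseteq> cbox c (c + s)"
  by (auto simp: hbox_def mem_box_cart less_imp_le)

lemma negligible_cbox_diff_hbox: "negligible (cbox c (c + s) - hbox c s)"
  by (rule negligible_subset[OF negligible_frontier_interval[of c "c + s"]])
     (use box_hbox_cbox[of c s] in auto)

lemma hbox_lmeasurable: "hbox c s \<in> lmeasurable"
  by (rule fmeasurableI2[OF lmeasurable_cbox box_hbox_cbox(2)]) simp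

lemma measure_hbox:
  fixes c s :: "real ^ 'n"
  assumes "\<And>i. 0 < s $ i"
  shows "measure lebesgue (hbox c s) = (\<Prod>i\<in>UNIV. s $ i)"
proof -
  have "measure lebesgue (hbox c s) = measure lebesgue (cbox c (c + s))"
    using box_hbox_cbox(2)[of c s]
    by (intro measure_negligible_symdiff)
       (auto intro: negligible_subset[OF negligible_cbox_diff_hbox[of c s]])
  also have "\<dots> = measure lborel (cbox c (c + s))" by simp
  also have "\<dots> = (\<Prod>i\<in>UNIV. (c + s) $ i - c $ i)"
    by (intro content_cbox_cart) (auto simp: interval_ne_empty_cart assms less_imp_le)
  finally show ?thesis by simp
qed

text \<open>The dyadic cell of level \<open>k\<close> around \<open>x\<close>, in the grid with origin \<open>a\<close> and mesh \<open>s / 2 ^ k\<close>. Describing it as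
the class of all points with the same integer coordinates makes the cells of one level a
partition by construction.\<close>

definition cell :: "real ^ 'n \<Rightarrow> real ^ 'n \<Rightarrow> nat \<Rightarrow> real ^ 'n \<Rightarrow> (real ^ 'n) set" where
  "cell a s k x =
     {y. \<forall>i. \<lfloor>2 ^ k * ((y $ i - a $ i) / s $ i)\<rfloor> = \<lfloor>2 ^ k * ((x $ i - a $ i) / s $ i)\<rfloor>}"

lemma mem_cell_self [simp]: "x \<in> cell a s k x"
  by (simp add: cell_def)

lemma cell_eq: "y \<in> cell a s k x \<Longrightarrow> cell a s k y = cell a s k x"
  by (auto simp: cell_def)

text \<open>The integer coordinates at level \<open>k\<close> are those at level \<open>l\<close> divided by \<open>2 ^ (l - k)\<close>, rounding down;
hence finer cells determine coarser ones.\<close>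

lemma floor_dyadic_refine:
  fixes t u :: real
  assumes "\<lfloor>2 ^ l * t\<rfloor> = \<lfloor>2 ^ l * u\<rfloor>" "k \<le> l"
  shows "\<lfloor>2 ^ k * t\<rfloor> = \<lfloor>2 ^ k * u\<rfloor>"
proof -
  have "\<lfloor>2 ^ k * v\<rfloor> = \<lfloor>2 ^ l * v\<rfloor> div 2 ^ (l - k)" for v :: real
  proof -
    have "2 ^ k * v = (2 ^ l * v) / of_nat (2 ^ (l - k))"
      using assms(2) by (simp add: field_simps flip: power_add)
    then show ?thesis
      by (metis floor_divide_real_eq_div of_int_of_nat_eq of_nat_0_le_iff of_nat_numeral of_nat_power)
  qed
  with assms(1) show ?thesis by simp
qed

lemma cell_antimono: "k \<le> l \<Longrightarrow> cell a s l x \<subseteq> cell a s k x"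
  unfolding cell_def using floor_dyadic_refine by blast

lemma cell_eq_hbox:
  fixes a s x :: "real ^ 'n"
  assumes s: "\<And>i. 0 < s $ i"
  shows "\<exists>c. cell a s k x = hbox c ((1 / 2 ^ k) *\<^sub>R s)"
proof -
  define c where "c = (\<chi> i. a $ i + real_of_int \<lfloor>2 ^ k * ((x $ i - a $ i) / s $ i)\<rfloor> * s $ i / 2 ^ k)"
  have "(\<lfloor>2 ^ k * ((y $ i - a $ i) / s $ i)\<rfloor> = \<lfloor>2 ^ k * ((x $ i - a $ i) / s $ i)\<rfloor>) \<longleftrightarrow>
     c $ i \<le> y $ i \<and> y $ i < c $ i + ((1 / 2 ^ k) *\<^sub>R s) $ i" for y i
    using s[of i] by (simp add: c_def floor_eq_iff field_simps)
  then show ?thesis by (auto simp: cell_def hbox_def)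
qed

lemma cell_0:
  assumes s: "\<And>i. 0 < s $ i" and "x \<in> hbox a s"
  shows "cell a s 0 x = hbox a s"
proof -
  have *: "y \<in> hbox a s \<longleftrightarrow> (\<forall>i. \<lfloor>(y $ i - a $ i) / s $ i\<rfloor> = 0)" for y
    using s by (simp add: hbox_def floor_eq_iff field_simps)
  show ?thesis using assms(2) unfolding * by (auto simp: cell_def *)
qed

lemma cell_subset:
  assumes "\<And>i. 0 < s $ i" "x \<in> hbox a s"
  shows "cell a s k x \<subseteq> hbox a s"
  using cell_antimono[of 0 k a s x] cell_0[OF assms] by simp

lemma cell_lmeasurable:
  assumes "\<And>i. 0 < s $ i"
  shows "cell a s k x \<in> lmeasurable"
  using cell_eq_hbox[OF assms, of a k x] hbox_lmeasurable by metis

lemma measure_cell: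
  fixes a s x :: "real ^ 'n"
  assumes s: "\<And>i. 0 < s $ i"
  shows "measure lebesgue (cell a s k x) = (\<Prod>i\<in>UNIV. s $ i) / (2 ^ k) ^ CARD('n)"
proof -
  obtain c where "cell a s k x = hbox c ((1 / 2 ^ k) *\<^sub>R s)" 
    using cell_eq_hbox[OF s] by blast
  moreover have "(\<Prod>i\<in>UNIV. ((1 / 2 ^ k) *\<^sub>R s) $ i) = (\<Prod>i\<in>UNIV. s $ i) / (2 ^ k) ^ CARD('n)"
    by (simp add: prod_dividef)
  moreover have "measure lebesgue (hbox c ((1 / 2 ^ k) *\<^sub>R s)) = (\<Prod>i\<in>UNIV. ((1 / 2 ^ k) *\<^sub>R s) $ i)"
    by (rule measure_hbox) (simp add: s)
  ultimately show ?thesis by metis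
qed

lemma cell_inside_open:
  fixes a s x :: "real ^ 'n"
  assumes s: "\<And>i. 0 < s $ i" and "open U" "x \<in> U"
  shows "\<exists>k. cell a s k x \<subseteq> U"
proof -
  obtain e where e: "e > 0" "ball x e \<subseteq> U" using assms openE by blast
  define S where "S = (\<Sum>i\<in>UNIV. s $ i)"
  have "S > 0" unfolding S_def by (rule sum_pos) (auto simp: s)
  obtain k where k: "S / e < 2 ^ k" using real_arch_pow[of 2] by auto
  have "y \<in> ball x e" if y: "y \<in> cell a s k x" for y
  proof -
    have "\<bar>y $ i - x $ i\<bar> \<le> s $ i / 2 ^ k" for i
    proof -
      have "\<bar>2 ^ k * ((y $ i - a $ i) / s $ i) - 2 ^ k * ((x $ i - a $ i) / s $ i)\<bar> \<le> 1"
      proof -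
        have "\<bar>u - v\<bar> \<le> 1" if "\<lfloor>u\<rfloor> = \<lfloor>v\<rfloor>" for u v :: real
          using that by linarith
        then show ?thesis using y unfolding cell_def by blast
      qed
      also have "2 ^ k * ((y $ i - a $ i) / s $ i) - 2 ^ k * ((x $ i - a $ i) / s $ i)
         = (y $ i - x $ i) * (2 ^ k / s $ i)" by (simp add: diff_divide_distrib algebra_simps)
      finally have "\<bar>y $ i - x $ i\<bar> * (2 ^ k / s $ i) \<le> 1"
        using s[of i] by (simp only: abs_mult) simp
      moreover have "d \<le> s $ i / 2 ^ k" if "d * (2 ^ k / s $ i) \<le> 1" for d
        using that s[of i] by (simp add: field_simps)
      ultimately show ?thesis by blast
    qed
    then have "norm (y - x) \<le> (\<Sum>i\<in>UNIV. s $ i / 2 ^ k)"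
      by (intro order_trans[OF norm_le_l1_cart] sum_mono) auto
    also have "\<dots> = S / 2 ^ k" by (simp add: S_def sum_divide_distrib)
    also have "\<dots> < e" using k e by (simp add: field_simps)
    finally show ?thesis by (simp add: dist_norm norm_minus_commute)
  qed
  with e show ?thesis by blast
qed

lemma countable_cells:
  fixes a s :: "real ^ 'n"
  shows "countable {cell a s k x |k x. True}"
proof -
  have "{cell a s k x |k x. True} \<subseteq>
     (\<lambda>(k, v :: int ^ 'n). {y. \<forall>i. \<lfloor>2 ^ k * ((y $ i - a $ i) / s $ i)\<rfloor> = v $ i}) ` UNIV"
  proof clarify
    fix k and x :: "real ^ 'n"
    show "cell a s k x \<in> (\<lambda>(k, v :: int ^ 'n). {y. \<forall>i. \<lfloor>2 ^ k * ((y $ i - a $ i) / s $ i)\<rfloor> = v $ i}) ` UNIV"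
      by (rule image_eqI[of _ _ "(k, \<chi> i. \<lfloor>2 ^ k * ((x $ i - a $ i) / s $ i)\<rfloor>)"])
         (auto simp: cell_def)
  qed
  then show ?thesis by (rule countable_subset) (rule countable_image, simp)
qed

section \<open>Maximal cells with a given property\<close>

text \<open>Each point stops at the first level whose cell satisfies \<open>P\<close>. Two stopping cells that meet in \<open>z\<close>
have the same stopping level, because up to that level their points have the same cells as \<open>z\<close>; so
they are equal. Both the differentiation theorem and the Calderon-Zygmund decomposition below are
instances, for different \<open>P\<close>.\<close>

lemma stopping_cells:
  fixes a s :: "real ^ 'n"
  obtains D where "countable D" "disjoint D" 
    "\<Union>D = (\<Union>x\<in>X. \<Union>k\<in>{k. P (cell a s k x)}. cell a s k x)"
    "\<And>E. E \<in> D \<Longrightarrow> \<exists>x\<in>X. \<exists>k. E = cell a s k x \<and> P E \<and> (\<forall>j<k. \<not> P (cell a s j x))"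
proof -
  define D where "D = {cell a s k x |k x. x \<in> X \<and> P (cell a s k x) \<and> (\<forall>j<k. \<not> P (cell a s j x))}"
  have "countable D"
    by (rule countable_subset[OF _ countable_cells[of a s]]) (auto simp: D_def)
  moreover have "disjoint D"
  proof (rule disjointI)
    fix E E' assume "E \<in> D" "E' \<in> D" and ne: "E \<noteq> E'"
    then obtain k x k' x' where E: "E = cell a s k x" "P E" "\<forall>j<k. \<not> P (cell a s j x)"
      and E': "E' = cell a s k' x'" "P E'" "\<forall>j<k'. \<not> P (cell a s j x')"
      by (auto simp: D_def)
    show "E \<inter> E' = {}"
    proof (rule ccontr)
      assume "E \<inter> E' \<noteq> {}"
      then obtain z where z: "z \<in> cell a s k x" "z \<in> cell a s k' x'" using E E' by blast
      \<comment> \<open>Up to its stopping level, each point shares all its cells with \<open>z\<close>.\<close>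
      have 1: "cell a s j z = cell a s j x" if "j \<le> k" for j
        using cell_eq cell_antimono[OF that] z(1) by blast
      have 2: "cell a s j z = cell a s j x'" if "j \<le> k'" for j
        using cell_eq cell_antimono[OF that] z(2) by blast
      have "k = k'"
        using E E' 1 2 by (metis linorder_neqE_nat less_imp_le order_refl)
      then show False using 1 2 E E' ne by auto
    qed
  qed
  moreover have "\<Union>D = (\<Union>x\<in>X. \<Union>k\<in>{k. P (cell a s k x)}. cell a s k x)"
  proof (intro equalityI subsetI)
    fix y assume "y \<in> (\<Union>x\<in>X. \<Union>k\<in>{k. P (cell a s k x)}. cell a s k x)"
    then obtain x k where x: "x \<in> X" "P (cell a s k x)" "y \<in> cell a s k x" by blast
    define l where "l = (LEAST k. P (cell a s k x))"
    have "P (cell a s l x)" "l \<le> k" "\<forall>j<l. \<not> P (cell a s j x)"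
      unfolding l_def using x LeastI Least_le not_less_Least by (metis (mono_tags))+
    moreover from this have "y \<in> cell a s l x" using x cell_antimono by blast
    ultimately show "y \<in> \<Union>D" using x(1) unfolding D_def by blast
  qed (auto simp: D_def)
  moreover have "\<exists>x\<in>X. \<exists>k. E = cell a s k x \<and> P E \<and> (\<forall>j<k. \<not> P (cell a s j x))" if "E \<in> D" for E
    using that unfolding D_def by blast
  ultimately show ?thesis using that by blast
qed

text \<open>Estimates on single stopping cells are summed by this comparison, mostly with one of the two
functions constant.\<close>

lemma nn_integral_Union_le:
  assumes "countable D" "disjoint D" "D \<subseteq> sets M"
    and [measurable]: "u \<in> borel_measurable M" "v \<in> borel_measurable M"
    and le: "\<And>E. E \<in> D \<Longrightarrow> (\<integral>\<^sup>+x\<in>E. u x \<partial>M) \<le> (\<integral>\<^sup>+x\<in>E. v x \<partial>M)"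
  shows "(\<integral>\<^sup>+x\<in>\<Union>D. u x \<partial>M) \<le> (\<integral>\<^sup>+x\<in>\<Union>D. v x \<partial>M)"
proof -
  have *: "(\<integral>\<^sup>+x\<in>\<Union>D. w x \<partial>M) = (\<integral>\<^sup>+E. (\<integral>\<^sup>+x\<in>E. w x \<partial>M) \<partial>count_space D)"
    if [measurable]: "w \<in> borel_measurable M" for w
  proof -
    have D: "\<Union>D \<in> sets M" using assms by (auto intro: sets.countable_Union)
    have "(\<integral>\<^sup>+x\<in>\<Union>D. w x \<partial>M) = emeasure (density M w) (\<Union>E\<in>D. E)"
      using D by (simp add: emeasure_density)
    also have "\<dots> = (\<integral>\<^sup>+E. emeasure (density M w) E \<partial>count_space D)"
      using assms by (intro emeasure_UN_countable) (auto simp: disjoint_family_on_disjoint_image disjoint_family_on_def disjoint_def)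
    also have "\<dots> = (\<integral>\<^sup>+E. (\<integral>\<^sup>+x\<in>E. w x \<partial>M) \<partial>count_space D)"
      using assms by (intro nn_integral_cong) (auto simp: emeasure_density)
    finally show ?thesis .
  qed
  show ?thesis unfolding *[OF assms(4)] *[OF assms(5)]
    by (rule nn_integral_mono) (use le in auto)
qed

lemma cell_sets [measurable]: 
  assumes "\<And>i. 0 < s $ i" shows "cell a s k x \<in> sets lebesgue"
  using cell_lmeasurable[OF assms] by (rule fmeasurableD)

lemma emeasure_cell:
  assumes "\<And>i. 0 < s $ i"
  shows "emeasure lebesgue (cell a s k x) = ennreal (measure lebesgue (cell a s k x))"
  using cell_lmeasurable[OF assms] by (simp add: emeasure_eq_measure2)

section \<open>Differentiation and the Calderon-Zygmund decomposition\<close>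

text \<open>The one-sided Lebesgue differentiation theorem for dyadic cells. Let \<open>T\<close> be the part of \<open>X\<close> where \<open>F > l\<close>,
and cover it tightly by an open \<open>U\<close>. The maximal cells inside \<open>U\<close> with average at most \<open>l\<close> still cover
\<open>T\<close>, so the integral of \<open>F\<close> over \<open>T\<close> is at most \<open>l\<close> times the measure of \<open>U\<close>, hence, as \<open>U\<close> shrinks, at most \<open>l\<close> times the
measure of \<open>T\<close>. As \<open>F > l\<close> on \<open>T\<close>, this set is null.\<close>

lemma AE_le_of_cell_averages_le:
  fixes a s :: "real ^ 'n" and F :: "real ^ 'n \<Rightarrow> ennreal" and l :: real
  assumes s: "\<And>i. 0 < s $ i" and [measurable]: "F \<in> borel_measurable lebesgue"
    and X [measurable]: "X \<in> sets lebesgue" and XR: "X \<subseteq> hbox a s" and l: "0 \<le> l"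
    and avg: "\<And>x k. x \<in> X \<Longrightarrow>
      (\<integral>\<^sup>+y\<in>cell a s k x. F y \<partial>lebesgue) \<le> ennreal l * emeasure lebesgue (cell a s k x)"
  shows "AE x in lebesgue. x \<in> X \<longrightarrow> F x \<le> ennreal l"
proof -
  define T where "T = {x \<in> space lebesgue. x \<in> X \<and> ennreal l < F x}"
  have [measurable]: "T \<in> sets lebesgue" unfolding T_def by measurable
  have TX: "T \<subseteq> X" by (auto simp: T_def)
  have "emeasure lebesgue T \<le> emeasure lebesgue (hbox a s)"
    using TX XR by (intro emeasure_mono) auto
  also have "\<dots> < \<infinity>" using hbox_lmeasurable[of a s] by (simp add: fmeasurable_def)
  finally have Tfin: "emeasure lebesgue T < \<infinity>" .
  have le: "(\<integral>\<^sup>+x\<in>T. F x \<partial>lebesgue) \<le> ennreal l * emeasure lebesgue T"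
  proof (rule ennreal_le_epsilon)
    fix e :: real assume e: "0 < e"
    \<comment> \<open>The denominator is \<open>l + 1\<close> since \<open>l\<close> may vanish.\<close>
    define d where "d = e / (l + 1)"
    have d: "0 < d" "l * d \<le> e" using e l by (auto simp: d_def field_simps)
    obtain U where U: "open U" "T \<subseteq> U" "emeasure lebesgue (U - T) < ennreal d"
      using sets_lebesgue_outer_open[OF \<open>T \<in> sets lebesgue\<close> d(1)] by metis
    have [measurable]: "U \<in> sets lebesgue" using U by auto
    define P where "P E \<longleftrightarrow> E \<subseteq> U \<and> (\<integral>\<^sup>+y\<in>E. F y \<partial>lebesgue) \<le> ennreal l * emeasure lebesgue E" for E
    obtain D where D: "countable D" "disjoint D" 
      and UD: "\<Union>D = (\<Union>x\<in>T. \<Union>k\<in>{k. P (cell a s k x)}. cell a s k x)"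
      and DP: "\<And>E. E \<in> D \<Longrightarrow> \<exists>x\<in>T. \<exists>k. E = cell a s k x \<and> P E \<and> (\<forall>j<k. \<not> P (cell a s j x))"
      using stopping_cells[where X=T and P=P and a=a and s=s] by blast
    have Ds: "D \<subseteq> sets lebesgue" using DP cell_sets[OF s] by blast
    have [measurable]: "\<Union>D \<in> sets lebesgue" using D(1) Ds by (auto intro: sets.countable_Union)
    have TD: "T \<subseteq> \<Union>D"
    proof
      fix x assume x: "x \<in> T"
      obtain k where "cell a s k x \<subseteq> U" using cell_inside_open[OF s U(1)] x U(2) by blast
      then have "P (cell a s k x)" using avg x TX by (auto simp: P_def)
      then show "x \<in> \<Union>D" unfolding UD using x by (auto intro: mem_cell_self)
    qed
    have DU: "\<Union>D \<subseteq> U" using DP unfolding P_def by blast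
    have "(\<integral>\<^sup>+x\<in>T. F x \<partial>lebesgue) \<le> (\<integral>\<^sup>+x\<in>\<Union>D. F x \<partial>lebesgue)"
      using TD by (intro nn_integral_mono mult_left_mono) (auto simp: indicator_def)
    also have "\<dots> \<le> (\<integral>\<^sup>+x\<in>\<Union>D. ennreal l \<partial>lebesgue)"
    proof (rule nn_integral_Union_le[OF D Ds])
      fix E assume "E \<in> D"
      moreover from this have "E \<in> sets lebesgue" using Ds by blast
      ultimately show "(\<integral>\<^sup>+x\<in>E. F x \<partial>lebesgue) \<le> (\<integral>\<^sup>+x\<in>E. ennreal l \<partial>lebesgue)"
        using DP[of E] by (auto simp: P_def nn_integral_cmult_indicator)
    qed auto
    also have "\<dots> = ennreal l * emeasure lebesgue (\<Union>D)" by (simp add: nn_integral_cmult_indicator)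
    also have "\<dots> \<le> ennreal l * emeasure lebesgue U"
      using DU by (intro mult_left_mono emeasure_mono) auto
    also have "emeasure lebesgue U = emeasure lebesgue T + emeasure lebesgue (U - T)"
      using U(2) by (subst plus_emeasure) (auto simp: Un_absorb1)
    also have "\<dots> \<le> emeasure lebesgue T + ennreal d" using U(3) by (intro add_left_mono) auto
    also have "ennreal l * (emeasure lebesgue T + ennreal d)
        = ennreal l * emeasure lebesgue T + ennreal (l * d)"
      using l d by (simp add: distrib_left ennreal_mult)
    also have "\<dots> \<le> ennreal l * emeasure lebesgue T + ennreal e"
      using d(2) by (intro add_left_mono ennreal_leI)
    finally show "(\<integral>\<^sup>+x\<in>T. F x \<partial>lebesgue) \<le> ennreal l * emeasure lebesgue T + ennreal e"
      by (simp add: mult_left_mono)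
  qed
  have "(\<integral>\<^sup>+x\<in>T. (F x - ennreal l) \<partial>lebesgue) + ennreal l * emeasure lebesgue T
      = (\<integral>\<^sup>+x. (F x - ennreal l) * indicator T x + ennreal l * indicator T x \<partial>lebesgue)"
    by (subst nn_integral_add) (auto simp: nn_integral_cmult_indicator)
  also have "\<dots> = (\<integral>\<^sup>+x\<in>T. F x \<partial>lebesgue)"
    by (intro nn_integral_cong) (auto simp: T_def indicator_def less_imp_le diff_add_cancel_ennreal)
  also note le
  finally have "ennreal l * emeasure lebesgue T + (\<integral>\<^sup>+x\<in>T. (F x - ennreal l) \<partial>lebesgue)
      \<le> ennreal l * emeasure lebesgue T + 0"
    by (simp add: add.commute)
  moreover have "ennreal l * emeasure lebesgue T \<noteq> \<infinity>"
    using Tfin by (simp add: ennreal_mult_eq_top_iff)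
  ultimately have "(\<integral>\<^sup>+x\<in>T. (F x - ennreal l) \<partial>lebesgue) = 0"
    by (simp only: ennreal_add_left_cancel_le) simp
  then have "AE x in lebesgue. (F x - ennreal l) * indicator T x = 0"
    by (subst (asm) nn_integral_0_iff_AE) auto
  then show ?thesis
    by eventually_elim (auto simp: T_def indicator_def not_less diff_eq_0_iff_ennreal split: if_splits)
qed

text \<open>Take the maximal cells with average of \<open>F\<close> above \<open>l\<close>. None of them is the whole box, so each has a
parent with average at most \<open>l\<close>, and a parent is \<open>2 ^ n\<close> times as large in dimension \<open>n\<close>. A point outside all of them
only has cells with average at most \<open>l\<close>.\<close>

lemma calderon_zygmund_decomposition:
  fixes a s :: "real ^ 'n" and F :: "real ^ 'n \<Rightarrow> ennreal" and l :: real
  assumes s: "\<And>i. 0 < s $ i" and [measurable]: "F \<in> borel_measurable lebesgue" and l: "0 < l"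
    and avg: "(\<integral>\<^sup>+y\<in>hbox a s. F y \<partial>lebesgue) \<le> ennreal l * emeasure lebesgue (hbox a s)"
  obtains D where "countable D" "disjoint D"
    "\<And>E. E \<in> D \<Longrightarrow> \<exists>x\<in>hbox a s. \<exists>k. E = cell a s k x"
    "\<And>E. E \<in> D \<Longrightarrow> ennreal l * emeasure lebesgue E \<le> (\<integral>\<^sup>+y\<in>E. F y \<partial>lebesgue)"
    "\<And>E. E \<in> D \<Longrightarrow> (\<integral>\<^sup>+y\<in>E. F y \<partial>lebesgue) \<le> ennreal (2 ^ CARD('n) * l) * emeasure lebesgue E"
    "AE x in lebesgue. x \<in> hbox a s - \<Union>D \<longrightarrow> F x \<le> ennreal l"
proof -
  define P where "P E \<longleftrightarrow> ennreal l * emeasure lebesgue E < (\<integral>\<^sup>+y\<in>E. F y \<partial>lebesgue)" for E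
  obtain D where D: "countable D" "disjoint D" 
    and UD: "\<Union>D = (\<Union>x\<in>hbox a s. \<Union>k\<in>{k. P (cell a s k x)}. cell a s k x)"
    and DP: "\<And>E. E \<in> D \<Longrightarrow> \<exists>x\<in>hbox a s. \<exists>k. E = cell a s k x \<and> P E \<and> (\<forall>j<k. \<not> P (cell a s j x))"
    using stopping_cells[where X="hbox a s" and P=P and a=a and s=s] by blast
  have Ds: "D \<subseteq> sets lebesgue" using DP cell_sets[OF s] by blast
  have [measurable]: "\<Union>D \<in> sets lebesgue" using D(1) Ds by (auto intro: sets.countable_Union)
  have "AE x in lebesgue. x \<in> hbox a s - \<Union>D \<longrightarrow> F x \<le> ennreal l"
  proof (rule AE_le_of_cell_averages_le[OF s])
    fix x k assume "x \<in> hbox a s - \<Union>D"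
    then have "\<not> P (cell a s k x)" unfolding UD using mem_cell_self by blast
    then show "(\<integral>\<^sup>+y\<in>cell a s k x. F y \<partial>lebesgue) \<le> ennreal l * emeasure lebesgue (cell a s k x)"
      by (simp add: P_def)
  qed (use l in auto)
  moreover have "(\<integral>\<^sup>+y\<in>E. F y \<partial>lebesgue) \<le> ennreal (2 ^ CARD('n) * l) * emeasure lebesgue E"
    if ED: "E \<in> D" for E
  proof -
    obtain x k where x: "x \<in> hbox a s" and E: "E = cell a s k x" "P E"
      and nP: "\<forall>j<k. \<not> P (cell a s j x)" using DP[OF ED] by blast
    have "\<not> P (hbox a s)" using avg by (simp only: P_def not_less)
    then have "k \<noteq> 0" using E cell_0[OF s x] by metis
    then obtain j where j: "k = Suc j" by (cases k) auto
    have "(\<integral>\<^sup>+y\<in>E. F y \<partial>lebesgue) \<le> (\<integral>\<^sup>+y\<in>cell a s j x. F y \<partial>lebesgue)"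
      using cell_antimono[of j k a s x] unfolding E(1) j
      by (intro nn_integral_mono mult_left_mono) (auto simp: indicator_def)
    also have "\<dots> \<le> ennreal l * emeasure lebesgue (cell a s j x)"
      using nP j by (auto simp: P_def not_less)
    also have "emeasure lebesgue (cell a s j x) = ennreal (2 ^ CARD('n) * measure lebesgue E)"
      unfolding emeasure_cell[OF s] E(1) measure_cell[OF s] j by (simp add: power_mult_distrib)
    also have "ennreal l * \<dots> = ennreal (2 ^ CARD('n) * l) * emeasure lebesgue E"
      using l unfolding E(1) emeasure_cell[OF s] by (simp add: ennreal_mult[symmetric] mult_ac)
    finally show ?thesis .
  qed
  moreover have "\<exists>x\<in>hbox a s. \<exists>k. E = cell a s k x" if "E \<in> D" for E
    using DP[OF that] by blast
  moreover have "ennreal l * emeasure lebesgue E \<le> (\<integral>\<^sup>+y\<in>E. F y \<partial>lebesgue)" if "E \<in> D" for E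
    using DP[OF that] unfolding P_def by (blast intro: less_imp_le)
  ultimately show ?thesis using D by (intro that)
qed

section \<open>Boxes of bounded eccentricity\<close>

text \<open>For a cube \<open>Q\<close> and \<open>x \<in> Q\<close>, the sets \<open>cube x \<rho> \<inter> Q\<close> are boxes of this shape up to null sets, but their dyadic pieces are in
general not of the form \<open>cube y \<sigma> \<inter> Q\<close>. The induction over stopping cells therefore runs in this
larger class, which is closed under dyadic subdivision.\<close>

definition fat_boxes :: "(real ^ 'n) set \<Rightarrow> (real ^ 'n) set set" where
  "fat_boxes Q = {hbox c s | c s. hbox c s \<subseteq> Q \<and> (\<exists>\<rho>>0. \<forall>i. \<rho> \<le> s $ i \<and> s $ i \<le> 2 * \<rho>)}"

lemma fat_boxes_cell:
  fixes a s :: "real ^ 'n"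
  assumes "hbox a s \<subseteq> Q" "0 < \<rho>" and s: "\<And>i. \<rho> \<le> s $ i \<and> s $ i \<le> 2 * \<rho>" and x: "x \<in> hbox a s"
  shows "cell a s k x \<in> fat_boxes Q"
proof -
  have pos: "0 < s $ i" for i using assms(2) s[of i] by linarith
  obtain c where c: "cell a s k x = hbox c ((1 / 2 ^ k) *\<^sub>R s)" using cell_eq_hbox[OF pos] by blast
  have "hbox c ((1 / 2 ^ k) *\<^sub>R s) \<subseteq> Q" using cell_subset[OF pos x, of k] assms(1) c by simp
  moreover have "\<rho> / 2 ^ k > 0" "\<forall>i. \<rho> / 2 ^ k \<le> ((1 / 2 ^ k) *\<^sub>R s) $ i \<and> ((1 / 2 ^ k) *\<^sub>R s) $ i \<le> 2 * (\<rho> / 2 ^ k)"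
    using s assms(2) by (auto simp: field_simps)
  ultimately show ?thesis unfolding fat_boxes_def c by blast
qed

lemma fat_boxes_lmeasurable: "R \<in> fat_boxes Q \<Longrightarrow> R \<in> lmeasurable"
  unfolding fat_boxes_def using hbox_lmeasurable by blast

lemma measure_fat_box_pos:
  assumes "R \<in> fat_boxes Q" shows "0 < measure lebesgue R"
proof -
  obtain c s \<rho> where R: "R = hbox c s" "0 < \<rho>" "\<forall>i. \<rho> \<le> s $ i \<and> s $ i \<le> 2 * \<rho>"
    using assms unfolding fat_boxes_def by blast
  then have "0 < s $ i" for i by (meson less_le_trans)
  then show ?thesis unfolding R(1) by (subst measure_hbox) (auto intro: prod_pos)
qed

section \<open>Self-improvement of the oscillation bound\<close>

text \<open>As \<open>c\<close> is nonnegative, \<open>\<bar>\<bar>t\<bar> - c\<bar> \<le> \<bar>t - c\<bar>\<close>. This is how means of \<open>\<bar>f\<bar>\<close> are compared although the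
oscillation is that of \<open>f\<close>, so that the classical argument for functions of bounded mean oscillation
applies without splitting \<open>f\<close> into its positive and negative parts.\<close>

lemma mean_abs_deviation_le:
  fixes f :: "real ^ 'n \<Rightarrow> real"
  assumes f: "integrable lebesgue f" and E: "E \<in> lmeasurable" "0 < measure lebesgue E" and c: "0 \<le> c"
  shows "ennreal \<bar>mean_abs E f - c\<bar> * emeasure lebesgue E \<le> (\<integral>\<^sup>+x\<in>E. ennreal \<bar>f x - c\<bar> \<partial>lebesgue)"
proof -
  have Es [measurable]: "E \<in> sets lebesgue" using E(1) by (rule fmeasurableD)
  have [measurable]: "f \<in> borel_measurable lebesgue" using f by simp
  have ic: "set_integrable lebesgue E (\<lambda>x. c)" using E(1)
    by (simp add: set_integrable_def fmeasurable_def lmeasurable_iff_integrable)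
  have iF: "set_integrable lebesgue E f" 
    unfolding set_integrable_def by (rule integrable_mult_indicator[OF Es f])
  have ia: "set_integrable lebesgue E (\<lambda>x. \<bar>f x\<bar>)" using iF by (rule set_integrable_abs)
  have i1: "set_integrable lebesgue E (\<lambda>x. \<bar>f x\<bar> - c)" using set_integral_diff(1)[OF ia ic] .
  have i2: "set_integrable lebesgue E (\<lambda>x. \<bar>f x - c\<bar>)"
    using set_integrable_abs[OF set_integral_diff(1)[OF iF ic]] .
  have "(mean_abs E f - c) * measure lebesgue E = (LINT x:E|lebesgue. \<bar>f x\<bar>) - (LINT x:E|lebesgue. c)"
    using E by (simp add: mean_abs_def field_simps set_lebesgue_integral_def fmeasurable_def)
  also have "\<dots> = (LINT x:E|lebesgue. \<bar>f x\<bar> - c)" using set_integral_diff(2)[OF ia ic] by simp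
  finally have "\<bar>mean_abs E f - c\<bar> * measure lebesgue E = \<bar>LINT x:E|lebesgue. \<bar>f x\<bar> - c\<bar>"
    using E(2) by (metis abs_mult abs_of_pos)
  also have "\<dots> \<le> (LINT x:E|lebesgue. \<bar>\<bar>f x\<bar> - c\<bar>)"
    using set_integral_norm_bound[OF i1] by simp
  also have "\<dots> \<le> (LINT x:E|lebesgue. \<bar>f x - c\<bar>)"
    by (rule set_integral_mono[OF set_integrable_abs[OF i1] i2]) (use c in auto)
  finally have "ennreal (\<bar>mean_abs E f - c\<bar> * measure lebesgue E) \<le> ennreal (LINT x:E|lebesgue. \<bar>f x - c\<bar>)"
    by (rule ennreal_leI)
  also have "ennreal (LINT x:E|lebesgue. \<bar>f x - c\<bar>) = (\<integral>\<^sup>+x. ennreal (indicator E x *\<^sub>R \<bar>f x - c\<bar>) \<partial>lebesgue)"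
    unfolding set_lebesgue_integral_def using i2
    by (subst nn_integral_eq_integral) (auto simp: set_integrable_def)
  also have "\<dots> = (\<integral>\<^sup>+x\<in>E. ennreal \<bar>f x - c\<bar> \<partial>lebesgue)"
    by (intro nn_integral_cong) (auto simp: indicator_def)
  finally show ?thesis using E(1) by (simp add: ennreal_mult emeasure_eq_measure2)
qed

lemma powr_add_le:
  fixes u v p :: real
  assumes "0 \<le> u" "0 \<le> v" "0 < p"
  shows "(u + v) powr p \<le> 2 powr p * (u powr p + v powr p)"
proof -
  have "(u + v) powr p \<le> (2 * max u v) powr p" using assms by (intro powr_mono2) auto
  also have "\<dots> = 2 powr p * max u v powr p" using assms by (simp add: powr_mult)
  also have "\<dots> \<le> 2 powr p * (u powr p + v powr p)" by (intro mult_left_mono) (auto simp: max_def)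
  finally show ?thesis .
qed

text \<open>Decompose \<open>R\<close> at height \<open>l\<close> for the function \<open>\<bar>f - m\<bar>\<close>, where \<open>m\<close> is the mean of \<open>\<bar>f\<bar>\<close> on \<open>R\<close>. Off the
stopping cells the integrand is at most \<open>l powr p\<close>. On a stopping cell the mean of \<open>\<bar>f\<bar>\<close> differs from
\<open>m\<close> by at most \<open>L\<close>, and the hypothesis on truncated oscillations applies to the cell itself. The
stopping cells fill at most the fraction \<open>K / l\<close> of \<open>R\<close>, and \<open>l = 2 powr p * 2 * K\<close> is chosen so that this
fraction compensates the factor \<open>2 powr p\<close> of the triangle inequality and leaves \<open>1 / 2\<close>.
The truncation at \<open>N\<close> provides an a priori bound from which the improvement can start.\<close>

lemma truncated_oscillation_improve:
  fixes f :: "real ^ 'n \<Rightarrow> real"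
  assumes f: "integrable lebesgue f" and p: "1 < p" and K: "0 < K" and N: "0 \<le> N" and B: "0 \<le> B"
    and osc: "\<And>R. R \<in> fat_boxes Q \<Longrightarrow>
      (\<integral>\<^sup>+x\<in>R. ennreal \<bar>f x - mean_abs R f\<bar> \<partial>lebesgue) \<le> ennreal K * emeasure lebesgue R"
    and bd: "\<And>R. R \<in> fat_boxes Q \<Longrightarrow>
      (\<integral>\<^sup>+x\<in>R. ennreal (min \<bar>f x - mean_abs R f\<bar> N powr p) \<partial>lebesgue) \<le> ennreal B * emeasure lebesgue R"
    and R: "R \<in> fat_boxes Q"
  defines "L \<equiv> 2 ^ CARD('n) * (2 powr p * 2 * K)"
  shows "(\<integral>\<^sup>+x\<in>R. ennreal (min \<bar>f x - mean_abs R f\<bar> N powr p) \<partial>lebesgue)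
      \<le> ennreal (B / 2 + 2 * L powr p) * emeasure lebesgue R"
proof -
  define l where "l = 2 powr p * 2 * K"
  have p1: "2 powr p \<ge> 1" using p by (intro ge_one_powr_ge_zero) auto
  have l: "0 < l" "K \<le> l" using K p1 mult_right_mono[OF p1, of "2 * K"] by (auto simp: l_def)
  have Ll: "L = 2 ^ CARD('n) * l" by (simp add: L_def l_def)
  have L: "0 < L" "l \<le> L" using l mult_right_mono[of 1 "2 ^ CARD('n)" l] by (auto simp: Ll)
  obtain a s \<rho> where Rh: "R = hbox a s" and RQ: "hbox a s \<subseteq> Q" and \<rho>: "0 < \<rho>"
    and s: "\<And>i. \<rho> \<le> s $ i \<and> s $ i \<le> 2 * \<rho>"
    using R unfolding fat_boxes_def by blast
  have spos: "0 < s $ i" for i using \<rho> s[of i] by linarith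
  have [measurable]: "f \<in> borel_measurable lebesgue" using f by simp
  have Rs [measurable]: "R \<in> sets lebesgue" using fat_boxes_lmeasurable[OF R] by (rule fmeasurableD)
  define m where "m = mean_abs R f"
  have m0: "0 \<le> m" by (simp add: m_def mean_abs_def set_lebesgue_integral_def)
  define F where "F x = ennreal \<bar>f x - m\<bar>" for x
  have [measurable]: "F \<in> borel_measurable lebesgue" unfolding F_def by measurable
  have FR: "(\<integral>\<^sup>+x\<in>R. F x \<partial>lebesgue) \<le> ennreal K * emeasure lebesgue R"
    using osc[OF R] by (simp add: F_def m_def)
  also have "\<dots> \<le> ennreal l * emeasure lebesgue R" using l by (intro mult_right_mono ennreal_leI) auto
  finally have "(\<integral>\<^sup>+x\<in>hbox a s. F x \<partial>lebesgue) \<le> ennreal l * emeasure lebesgue (hbox a s)"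
    by (simp add: Rh)
  from calderon_zygmund_decomposition[OF spos \<open>F \<in> borel_measurable lebesgue\<close> l(1) this]
  obtain D where D: "countable D" "disjoint D"
    and Dcell: "\<And>E. E \<in> D \<Longrightarrow> \<exists>x\<in>hbox a s. \<exists>k. E = cell a s k x"
    and Dlow: "\<And>E. E \<in> D \<Longrightarrow> ennreal l * emeasure lebesgue E \<le> (\<integral>\<^sup>+y\<in>E. F y \<partial>lebesgue)"
    and Dup: "\<And>E. E \<in> D \<Longrightarrow> (\<integral>\<^sup>+y\<in>E. F y \<partial>lebesgue) \<le> ennreal L * emeasure lebesgue E"
    and Dout: "AE x in lebesgue. x \<in> hbox a s - \<Union>D \<longrightarrow> F x \<le> ennreal l"
    unfolding Ll by blast
  have Dfat: "E \<in> fat_boxes Q" if "E \<in> D" for E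
    using Dcell[OF that] fat_boxes_cell[OF RQ \<rho> s] by blast
  have Dlm: "E \<in> lmeasurable" if "E \<in> D" for E using Dfat[OF that] by (rule fat_boxes_lmeasurable)
  have Ds: "D \<subseteq> sets lebesgue" using Dlm fmeasurableD by blast
  have [measurable]: "\<Union>D \<in> sets lebesgue" using D(1) Ds by (auto intro: sets.countable_Union)
  have DR: "\<Union>D \<subseteq> R" using Dcell cell_subset[OF spos] Rh by blast
  define G where "G x = ennreal (min \<bar>f x - m\<bar> N powr p)" for x
  have [measurable]: "G \<in> borel_measurable lebesgue" unfolding G_def by measurable
  define H where "H = 2 powr p * (B + L powr p)"
  have H0: "0 \<le> H" using B by (simp add: H_def)
  have "ennreal l * emeasure lebesgue (\<Union>D) = (\<integral>\<^sup>+x\<in>\<Union>D. ennreal l \<partial>lebesgue)"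
    by (simp add: nn_integral_cmult_indicator)
  also have "\<dots> \<le> (\<integral>\<^sup>+x\<in>\<Union>D. F x \<partial>lebesgue)"
  proof (rule nn_integral_Union_le[OF D Ds])
    fix E assume "E \<in> D"
    then show "(\<integral>\<^sup>+x\<in>E. ennreal l \<partial>lebesgue) \<le> (\<integral>\<^sup>+x\<in>E. F x \<partial>lebesgue)"
      using Dlow[of E] Ds by (auto simp: nn_integral_cmult_indicator)
  qed auto
  also have "\<dots> \<le> (\<integral>\<^sup>+x\<in>R. F x \<partial>lebesgue)"
    using DR by (intro nn_integral_mono mult_left_mono) (auto simp: indicator_def)
  also note FR
  finally have small: "ennreal l * emeasure lebesgue (\<Union>D) \<le> ennreal K * emeasure lebesgue R" .
  have inside: "(\<integral>\<^sup>+x\<in>E. G x \<partial>lebesgue) \<le> ennreal H * emeasure lebesgue E" if E: "E \<in> D" for E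
  proof -
    define e where "e = mean_abs E f"
    have [measurable]: "E \<in> sets lebesgue" using E Ds by blast
    have mpos: "0 < measure lebesgue E" using measure_fat_box_pos[OF Dfat[OF E]] .
    have "ennreal \<bar>e - m\<bar> * emeasure lebesgue E \<le> (\<integral>\<^sup>+x\<in>E. F x \<partial>lebesgue)"
      unfolding F_def e_def by (rule mean_abs_deviation_le[OF f Dlm[OF E] mpos m0])
    also have "\<dots> \<le> ennreal L * emeasure lebesgue E" by (rule Dup[OF E])
    finally have "ennreal (\<bar>e - m\<bar> * measure lebesgue E) \<le> ennreal (L * measure lebesgue E)"
      using Dlm[OF E] L by (simp add: emeasure_eq_measure2 ennreal_mult)
    then have em: "\<bar>e - m\<bar> \<le> L" using mpos L by simp
    have "min \<bar>f x - m\<bar> N powr p \<le> 2 powr p * (min \<bar>f x - e\<bar> N powr p + L powr p)" for x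
    proof -
      have "min \<bar>f x - m\<bar> N powr p \<le> (min \<bar>f x - e\<bar> N + L) powr p"
        using em N p L by (intro powr_mono2) auto
      also have "\<dots> \<le> 2 powr p * (min \<bar>f x - e\<bar> N powr p + L powr p)"
        using N p L by (intro powr_add_le) auto
      finally show ?thesis .
    qed
    then have "(\<integral>\<^sup>+x\<in>E. G x \<partial>lebesgue) \<le>
        (\<integral>\<^sup>+x. ennreal (2 powr p) * (ennreal (min \<bar>f x - e\<bar> N powr p) * indicator E x) 
           + ennreal (2 powr p * L powr p) * indicator E x \<partial>lebesgue)"
      unfolding G_def
      by (intro nn_integral_mono)
         (auto simp: indicator_def distrib_left simp flip: ennreal_mult ennreal_plus intro!: ennreal_leI)
    also have "\<dots> = ennreal (2 powr p) * (\<integral>\<^sup>+x\<in>E. ennreal (min \<bar>f x - e\<bar> N powr p) \<partial>lebesgue)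
           + ennreal (2 powr p * L powr p) * emeasure lebesgue E"
      by (simp add: nn_integral_add nn_integral_cmult nn_integral_cmult_indicator)
    also have "\<dots> \<le> ennreal (2 powr p) * (ennreal B * emeasure lebesgue E)
           + ennreal (2 powr p * L powr p) * emeasure lebesgue E"
      unfolding e_def by (intro add_right_mono mult_left_mono bd Dfat E) auto
    also have "\<dots> = ennreal H * emeasure lebesgue E"
      using B by (simp add: H_def distrib_left distrib_right ennreal_mult mult.assoc)
    finally show ?thesis .
  qed
  have "(\<integral>\<^sup>+x\<in>R. G x \<partial>lebesgue) \<le>
     (\<integral>\<^sup>+x. G x * indicator (\<Union>D) x + ennreal (l powr p) * indicator R x \<partial>lebesgue)"
  proof (rule nn_integral_mono_AE)
    show "AE x in lebesgue. G x * indicator R x \<le> G x * indicator (\<Union>D) x + ennreal (l powr p) * indicator R x"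
      using Dout
    proof eventually_elim
      fix x assume x: "x \<in> hbox a s - \<Union>D \<longrightarrow> F x \<le> ennreal l"
      have "G x \<le> ennreal (l powr p)" if "x \<in> R" "x \<notin> \<Union>D"
      proof -
        have "\<bar>f x - m\<bar> \<le> l" using x that l by (simp add: F_def Rh)
        then show ?thesis unfolding G_def using p N by (intro ennreal_leI powr_mono2) auto
      qed
      then show "G x * indicator R x \<le> G x * indicator (\<Union>D) x + ennreal (l powr p) * indicator R x"
        by (auto simp: indicator_def)
    qed
  qed
  also have "\<dots> = (\<integral>\<^sup>+x\<in>\<Union>D. G x \<partial>lebesgue) + ennreal (l powr p) * emeasure lebesgue R"
    by (simp add: nn_integral_add nn_integral_cmult_indicator)
  also have "(\<integral>\<^sup>+x\<in>\<Union>D. G x \<partial>lebesgue) \<le> (\<integral>\<^sup>+x\<in>\<Union>D. ennreal H \<partial>lebesgue)"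
  proof (rule nn_integral_Union_le[OF D Ds])
    fix E assume "E \<in> D"
    then show "(\<integral>\<^sup>+x\<in>E. G x \<partial>lebesgue) \<le> (\<integral>\<^sup>+x\<in>E. ennreal H \<partial>lebesgue)"
      using inside[of E] Ds by (auto simp: nn_integral_cmult_indicator)
  qed auto
  also have "(\<integral>\<^sup>+x\<in>\<Union>D. ennreal H \<partial>lebesgue) = ennreal (H / l) * (ennreal l * emeasure lebesgue (\<Union>D))"
    using l H0 by (simp add: nn_integral_cmult_indicator mult.assoc[symmetric] flip: ennreal_mult)
  also have "\<dots> \<le> ennreal (H / l) * (ennreal K * emeasure lebesgue R)"
    by (intro mult_left_mono small) auto
  also have "\<dots> = ennreal (H / l * K) * emeasure lebesgue R"
    using l H0 K by (simp add: mult.assoc[symmetric] flip: ennreal_mult)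
  also have "H / l * K = (B + L powr p) / 2" using K by (simp add: H_def l_def field_simps)
  also have "ennreal ((B + L powr p) / 2) * emeasure lebesgue R + ennreal (l powr p) * emeasure lebesgue R
     = ennreal ((B + L powr p) / 2 + l powr p) * emeasure lebesgue R"
    using B by (simp add: distrib_right)
  also have "\<dots> \<le> ennreal (B / 2 + 2 * L powr p) * emeasure lebesgue R"
  proof (intro mult_right_mono ennreal_leI)
    have "l powr p \<le> L powr p" using l L p by (intro powr_mono2) auto
    moreover have "(B + v) / 2 + u \<le> B / 2 + 2 * v" if "u \<le> v" "0 \<le> v" for u v :: real
      using that by (simp add: field_simps)
    ultimately show "(B + L powr p) / 2 + l powr p \<le> B / 2 + 2 * L powr p" by simp
  qed simp
  finally show ?thesis by (simp add: G_def m_def)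
qed

text \<open>The truncated oscillation is trivially bounded by \<open>N powr p\<close>. Each improvement step halves the bound and
adds \<open>2 * L powr p\<close>, so the bounds converge to the fixed point \<open>4 * L powr p\<close>, which is independent of \<open>N\<close>; then
\<open>N\<close> tends to infinity by monotone convergence.\<close>

lemma oscillation_Lp_bound:
  fixes f :: "real ^ 'n \<Rightarrow> real"
  assumes f: "integrable lebesgue f" and p: "1 < p" and K: "0 < K"
    and osc: "\<And>R. R \<in> fat_boxes Q \<Longrightarrow>
      (\<integral>\<^sup>+x\<in>R. ennreal \<bar>f x - mean_abs R f\<bar> \<partial>lebesgue) \<le> ennreal K * emeasure lebesgue R"
    and R: "R \<in> fat_boxes Q"
  defines "L \<equiv> 2 ^ CARD('n) * (2 powr p * 2 * K)"
  shows "(\<integral>\<^sup>+x\<in>R. ennreal (\<bar>f x - mean_abs R f\<bar> powr p) \<partial>lebesgue)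
      \<le> ennreal (4 * L powr p) * emeasure lebesgue R"
proof -
  have [measurable]: "f \<in> borel_measurable lebesgue" using f by simp
  have Rs [measurable]: "R \<in> sets lebesgue" using fat_boxes_lmeasurable[OF R] by (rule fmeasurableD)
  define m where "m = mean_abs R f"
  have trunc: "(\<integral>\<^sup>+x\<in>R. ennreal (min \<bar>f x - m\<bar> N powr p) \<partial>lebesgue)
      \<le> ennreal (4 * L powr p) * emeasure lebesgue R" if N: "0 \<le> N" for N :: real
  proof -
    have iter: "(\<integral>\<^sup>+x\<in>R. ennreal (min \<bar>f x - mean_abs R f\<bar> N powr p) \<partial>lebesgue)
      \<le> ennreal (N powr p / 2 ^ k + 4 * L powr p) * emeasure lebesgue R" 
      if "R \<in> fat_boxes Q" for R k
      using that
    proof (induction k arbitrary: R)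
      case 0
      have [measurable]: "R \<in> sets lebesgue" using fat_boxes_lmeasurable[OF 0] by (rule fmeasurableD)
      have "(\<integral>\<^sup>+x\<in>R. ennreal (min \<bar>f x - mean_abs R f\<bar> N powr p) \<partial>lebesgue)
         \<le> (\<integral>\<^sup>+x\<in>R. ennreal (N powr p / 2 ^ 0 + 4 * L powr p) \<partial>lebesgue)"
      proof (intro nn_integral_mono mult_right_mono ennreal_leI)
        fix x
        have "min \<bar>f x - mean_abs R f\<bar> N powr p \<le> N powr p" using N p by (intro powr_mono2) auto
        then show "min \<bar>f x - mean_abs R f\<bar> N powr p \<le> N powr p / 2 ^ 0 + 4 * L powr p"
          by (simp add: add_increasing2)
      qed simp
      then show ?case by (simp add: nn_integral_cmult_indicator)
    next
      case (Suc k)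
      have "(\<integral>\<^sup>+x\<in>R. ennreal (min \<bar>f x - mean_abs R f\<bar> N powr p) \<partial>lebesgue)
        \<le> ennreal ((N powr p / 2 ^ k + 4 * L powr p) / 2 + 2 * L powr p) * emeasure lebesgue R"
        unfolding L_def
        by (rule truncated_oscillation_improve[OF f p K N _ osc Suc.IH[unfolded L_def] Suc.prems]) auto
      also have "(N powr p / 2 ^ k + 4 * L powr p) / 2 + 2 * L powr p = N powr p / 2 ^ Suc k + 4 * L powr p"
        by (simp add: field_simps)
      finally show ?case .
    qed
    have "(\<lambda>k. N powr p * (1 / 2) ^ k + 4 * L powr p) \<longlonglongrightarrow> N powr p * 0 + 4 * L powr p"
      by (intro tendsto_intros LIMSEQ_power_zero) auto
    then have "(\<lambda>k. N powr p / 2 ^ k + 4 * L powr p) \<longlonglongrightarrow> 4 * L powr p"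
      by (simp add: power_divide)
    then have "(\<lambda>k. (N powr p / 2 ^ k + 4 * L powr p) * measure lebesgue R) \<longlonglongrightarrow> (4 * L powr p) * measure lebesgue R"
      by (rule tendsto_mult_right)
    then have "(\<lambda>k. ennreal ((N powr p / 2 ^ k + 4 * L powr p) * measure lebesgue R))
       \<longlonglongrightarrow> ennreal ((4 * L powr p) * measure lebesgue R)"
      by (rule tendsto_ennrealI)
    then have "(\<integral>\<^sup>+x\<in>R. ennreal (min \<bar>f x - m\<bar> N powr p) \<partial>lebesgue) \<le> ennreal ((4 * L powr p) * measure lebesgue R)"
      using iter[OF R] fat_boxes_lmeasurable[OF R] unfolding m_def
      by (intro LIMSEQ_le_const) (auto simp: emeasure_eq_measure2 ennreal_mult)
    then show ?thesis using fat_boxes_lmeasurable[OF R] by (simp add: emeasure_eq_measure2 ennreal_mult)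
  qed
  define u where "u N x = ennreal (min \<bar>f x - m\<bar> (real N) powr p) * indicator R x" for N x
  have "(\<integral>\<^sup>+x\<in>R. ennreal (\<bar>f x - m\<bar> powr p) \<partial>lebesgue) \<le> (\<integral>\<^sup>+x. (SUP N. u N x) \<partial>lebesgue)"
  proof (rule nn_integral_mono)
    fix x
    obtain N :: nat where "\<bar>f x - m\<bar> \<le> real N" using real_arch_simple by blast
    then have "ennreal (\<bar>f x - m\<bar> powr p) * indicator R x = u N x" by (simp add: u_def min_absorb1)
    also have "\<dots> \<le> (SUP N. u N x)" by (rule SUP_upper) simp
    finally show "ennreal (\<bar>f x - m\<bar> powr p) * indicator R x \<le> (SUP N. u N x)" .
  qed
  also have "\<dots> = (SUP N. (\<integral>\<^sup>+x. u N x \<partial>lebesgue))"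
  proof (rule nn_integral_monotone_convergence_SUP)
    show "incseq u" unfolding u_def using p
      by (intro incseq_SucI le_funI mult_right_mono ennreal_leI powr_mono2) auto
    show "u N \<in> borel_measurable lebesgue" for N unfolding u_def by measurable
  qed
  also have "\<dots> \<le> ennreal (4 * L powr p) * emeasure lebesgue R"
    unfolding u_def by (intro SUP_least trunc) simp
  finally show ?thesis by (simp add: m_def)
qed

section \<open>Truncated cubes and boxes\<close>

lemma cube_eq_cbox: "cube x \<rho> = cbox (\<chi> i. x $ i - \<rho>) (\<chi> i. x $ i + \<rho>)"
proof -
  have "\<bar>u - v\<bar> \<le> \<rho> \<longleftrightarrow> v - \<rho> \<le> u \<and> u \<le> v + \<rho>" for u v :: real by linarith
  then show ?thesis by (auto simp: cube_def mem_box_cart)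
qed

text \<open>For \<open>\<rho> \<le> 2 * r\<close> each side of the intersection is between \<open>\<rho>\<close> and \<open>2 * \<rho>\<close>, since \<open>x $ i\<close>
lies in the corresponding side of the large cube; beyond that size the intersection is the
whole cube. Hence \<open>min \<rho> (2 * r)\<close> is a scale that fits in both cases.\<close>

lemma cube_Int_fat_box:
  fixes x z :: "real ^ 'n"
  assumes r: "0 < r" and \<rho>: "0 < \<rho>" and x: "x \<in> cube z r"
  obtains R where "R \<in> fat_boxes (cube z r)" "R \<subseteq> cube x \<rho> \<inter> cube z r"
    "negligible ((cube x \<rho> \<inter> cube z r) - R)" "measure lebesgue R \<le> (2 * \<rho>) ^ CARD('n)"
proof -
  define c where "c = (\<chi> i. max (x $ i - \<rho>) (z $ i - r))"
  define s where "s = (\<chi> i. min (x $ i + \<rho>) (z $ i + r)) - c"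
  have eq: "cube x \<rho> \<inter> cube z r = cbox c (c + s)"
    by (auto simp: cube_eq_cbox mem_box_cart c_def s_def)
  have xi: "z $ i - r \<le> x $ i" "x $ i \<le> z $ i + r" for i
    using x unfolding cube_eq_cbox by (auto simp: mem_box_cart)
  have s: "min \<rho> (2 * r) \<le> s $ i \<and> s $ i \<le> 2 * min \<rho> (2 * r)" "s $ i \<le> 2 * \<rho>" for i
    using xi[of i] r \<rho> by (auto simp: s_def c_def)
  have pos: "0 < min \<rho> (2 * r)" using r \<rho> by simp
  have spos: "0 < s $ i" for i using pos s(1)[of i] by linarith
  have sub: "hbox c s \<subseteq> cube x \<rho> \<inter> cube z r" using box_hbox_cbox(2) eq by blast
  have "measure lebesgue (hbox c s) = (\<Prod>i\<in>UNIV. s $ i)" using spos by (rule measure_hbox)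
  also have "\<dots> \<le> (\<Prod>i\<in>(UNIV :: 'n set). 2 * \<rho>)"
    using s(2) spos by (intro prod_mono) (auto intro: less_imp_le)
  finally have "measure lebesgue (hbox c s) \<le> (2 * \<rho>) ^ CARD('n)" by simp
  moreover have "hbox c s \<in> fat_boxes (cube z r)"
    unfolding fat_boxes_def using sub s(1) pos by blast
  ultimately show ?thesis
    using that sub negligible_cbox_diff_hbox[of c s] unfolding eq by blast
qed

lemma barL_sup_le_iff:
  fixes f :: "real ^ 'n \<Rightarrow> real"
  assumes "0 \<le> B"
  shows "barL_sup q Q f \<le> ennreal B \<longleftrightarrow> (\<forall>x\<in>Q. \<forall>\<rho>>0.
     (\<integral>\<^sup>+y\<in>cube x \<rho> \<inter> Q. ennreal (\<bar>f y - mean_abs (cube x \<rho> \<inter> Q) f\<bar> powr q) \<partial>lebesgue)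
      \<le> ennreal (B * \<rho> ^ CARD('n)))"
proof -
  have "ennreal (1 / t) * I \<le> ennreal B \<longleftrightarrow> I \<le> ennreal (B * t)" if t: "0 < t" for t :: real and I
  proof
    assume "ennreal (1 / t) * I \<le> ennreal B"
    then have "ennreal t * (ennreal (1 / t) * I) \<le> ennreal t * ennreal B" by (rule mult_left_mono) simp
    also have "ennreal t * (ennreal (1 / t) * I) = I"
      using t by (simp add: mult.assoc[symmetric] flip: ennreal_mult)
    also have "ennreal t * ennreal B = ennreal (B * t)"
      using t assms by (simp add: mult.commute flip: ennreal_mult)
    finally show "I \<le> ennreal (B * t)" .
  next
    assume "I \<le> ennreal (B * t)"
    then have "ennreal (1 / t) * I \<le> ennreal (1 / t) * ennreal (B * t)" by (rule mult_left_mono) simp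
    then show "ennreal (1 / t) * I \<le> ennreal B"
      using t assms by (simp flip: ennreal_mult)
  qed
  then show ?thesis unfolding barL_sup_def by (auto simp: SUP_le_iff)
qed

text \<open>A fat box \<open>R\<close> of scale \<open>\<rho>\<close> lies in \<open>cube x \<rho> \<inter> Q\<close> for its centre \<open>x\<close> and has measure at least
\<open>\<rho> ^ n\<close> in dimension \<open>n\<close>; replacing the mean over the larger set by the mean over \<open>R\<close> costs the factor 2.\<close>

lemma fat_box_oscillation_le:
  fixes f :: "real ^ 'n \<Rightarrow> real"
  assumes f: "integrable lebesgue f" and M: "0 \<le> M" and sup: "barL_sup 1 Q f \<le> ennreal M"
    and R: "R \<in> fat_boxes Q"
  shows "(\<integral>\<^sup>+x\<in>R. ennreal \<bar>f x - mean_abs R f\<bar> \<partial>lebesgue) \<le> ennreal (2 * M) * emeasure lebesgue R"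
proof -
  have [measurable]: "f \<in> borel_measurable lebesgue" using f by simp
  have Rs [measurable]: "R \<in> sets lebesgue" using fat_boxes_lmeasurable[OF R] by (rule fmeasurableD)
  obtain c s \<rho> where Rh: "R = hbox c s" and RQ: "hbox c s \<subseteq> Q" and \<rho>: "0 < \<rho>"
    and s: "\<And>i. \<rho> \<le> s $ i \<and> s $ i \<le> 2 * \<rho>"
    using R unfolding fat_boxes_def by blast
  have spos: "0 < s $ i" for i using \<rho> s[of i] by linarith
  define x where "x = c + (1 / 2) *\<^sub>R s"
  have "x \<in> hbox c s" using spos by (auto simp: x_def hbox_def less_imp_le)
  then have xQ: "x \<in> Q" using RQ by blast
  have "\<bar>y $ i - x $ i\<bar> \<le> \<rho>" if "y \<in> hbox c s" for y i
  proof -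
    have "c $ i \<le> y $ i" "y $ i < c $ i + s $ i" using that by (auto simp: hbox_def)
    then show ?thesis using s[of i] by (simp add: x_def abs_le_iff)
  qed
  then have sub: "R \<subseteq> cube x \<rho> \<inter> Q" using RQ by (auto simp: Rh cube_def)
  define m where "m = mean_abs (cube x \<rho> \<inter> Q) f"
  have m: "0 \<le> m" by (simp add: m_def mean_abs_def set_lebesgue_integral_def)
  define J where "J = (\<integral>\<^sup>+y\<in>R. ennreal \<bar>f y - m\<bar> \<partial>lebesgue)"
  have "J \<le> (\<integral>\<^sup>+y\<in>cube x \<rho> \<inter> Q. ennreal (\<bar>f y - m\<bar> powr 1) \<partial>lebesgue)"
    unfolding J_def using sub by (intro nn_integral_mono) (auto simp: indicator_def)
  also have "\<dots> \<le> ennreal (M * \<rho> ^ CARD('n))"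
    using sup[unfolded barL_sup_le_iff[OF M]] xQ \<rho> unfolding m_def by blast
  also have "\<dots> \<le> ennreal (M * measure lebesgue R)"
  proof (intro ennreal_leI mult_left_mono M)
    have "\<rho> ^ CARD('n) = (\<Prod>i\<in>(UNIV :: 'n set). \<rho>)" by simp
    also have "\<dots> \<le> (\<Prod>i\<in>UNIV. s $ i)" using s \<rho> by (intro prod_mono) auto
    also have "\<dots> = measure lebesgue R" unfolding Rh by (rule measure_hbox[OF spos, symmetric])
    finally show "\<rho> ^ CARD('n) \<le> measure lebesgue R" .
  qed
  finally have J: "J \<le> ennreal (M * measure lebesgue R)" .
  have "(\<integral>\<^sup>+y\<in>R. ennreal \<bar>f y - mean_abs R f\<bar> \<partial>lebesgue)
     \<le> (\<integral>\<^sup>+y. ennreal \<bar>f y - m\<bar> * indicator R y + ennreal \<bar>mean_abs R f - m\<bar> * indicator R y \<partial>lebesgue)"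
    by (intro nn_integral_mono) (auto simp: indicator_def simp flip: ennreal_plus intro!: ennreal_leI)
  also have "\<dots> = J + ennreal \<bar>mean_abs R f - m\<bar> * emeasure lebesgue R"
    by (simp add: J_def nn_integral_add nn_integral_cmult_indicator)
  also have "\<dots> \<le> J + J" unfolding J_def
    by (intro add_left_mono mean_abs_deviation_le f fat_boxes_lmeasurable[OF R] measure_fat_box_pos[OF R] m)
  also have "\<dots> \<le> ennreal (M * measure lebesgue R) + ennreal (M * measure lebesgue R)"
    by (intro add_mono J)
  also have "\<dots> = ennreal (2 * M * measure lebesgue R)"
    using M by (simp flip: ennreal_plus)
  also have "\<dots> = ennreal (2 * M) * emeasure lebesgue R"
    using M fat_boxes_lmeasurable[OF R] by (simp add: emeasure_eq_measure2 ennreal_mult)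
  finally show ?thesis .
qed

lemma mean_abs_cong_negligible:
  assumes "E \<subseteq> E'" "negligible (E' - E)" "E \<in> sets lebesgue"
  and [measurable]: "f \<in> borel_measurable lebesgue"
  shows "mean_abs E' f = mean_abs E f"
proof -
  have ae: "AE x in lebesgue. x \<notin> E' - E"
    using assms(2) unfolding negligible_iff_null_sets by (rule AE_not_in)
  have "E' = E \<union> (E' - E)" using assms(1) by blast
  then have E': "E' \<in> sets lebesgue"
    using assms(2,3) by (metis negligible_imp_sets sets.Un)
  have "measure lebesgue E' = measure lebesgue E"
    using ae assms E' by (intro measure_eq_AE) (auto elim: eventually_mono)
  moreover have "(LINT y:E'|lebesgue. \<bar>f y\<bar>) = (LINT y:E|lebesgue. \<bar>f y\<bar>)"
    unfolding set_lebesgue_integral_def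
    by (intro integral_cong_AE) (use ae assms E' in \<open>auto elim!: eventually_mono simp: indicator_def\<close>)
  ultimately show ?thesis by (simp add: mean_abs_def)
qed

section \<open>Comparison of the two norms\<close>

lemma barL_sup_p_le:
  fixes f :: "real ^ 'n \<Rightarrow> real"
  assumes f: "integrable lebesgue f" and p: "1 < p" and r: "0 < r" and M: "0 < M"
    and sup: "barL_sup 1 (cube z r) f \<le> ennreal M"
  shows "barL_sup p (cube z r) f \<le> ennreal ((16 * 2 ^ CARD('n) * 2 ^ CARD('n) * 2 powr p * M) powr p)"
proof -
  have [measurable]: "f \<in> borel_measurable lebesgue" using f by simp
  define L where "L = 2 ^ CARD('n) * (2 powr p * 2 * (2 * M))"
  define C where "C = 4 * 2 ^ CARD('n) * L"
  have L0: "0 < L" using M by (simp add: L_def)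
  have C: "4 * L powr p * 2 ^ CARD('n) \<le> C powr p"
  proof -
    define b :: real where "b = 4 * 2 ^ CARD('n)"
    have "(1::real) \<le> 2 ^ CARD('n)" by (rule one_le_power) simp
    then have b: "1 \<le> b" unfolding b_def by linarith
    have "b powr 1 * L powr p \<le> b powr p * L powr p"
      using p b by (intro mult_right_mono powr_mono) auto
    also have "\<dots> = (b * L) powr p" using b L0 by (simp add: powr_mult)
    finally show ?thesis using b by (simp add: b_def C_def mult_ac)
  qed
  have "barL_sup p (cube z r) f \<le> ennreal (C powr p)"
    unfolding barL_sup_le_iff[OF powr_ge_zero]
  proof (intro ballI allI impI)
    fix x \<rho> assume x: "x \<in> cube z r" and \<rho>: "(0::real) < \<rho>"
    obtain R where R: "R \<in> fat_boxes (cube z r)" and sub: "R \<subseteq> cube x \<rho> \<inter> cube z r"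
      and neg: "negligible ((cube x \<rho> \<inter> cube z r) - R)" and mR: "measure lebesgue R \<le> (2 * \<rho>) ^ CARD('n)"
      using cube_Int_fat_box[OF r \<rho> x] by blast
    have Rs [measurable]: "R \<in> sets lebesgue" using fat_boxes_lmeasurable[OF R] by (rule fmeasurableD)
    have ae: "AE y in lebesgue. y \<notin> (cube x \<rho> \<inter> cube z r) - R"
      using neg unfolding negligible_iff_null_sets by (rule AE_not_in)
    have "(\<integral>\<^sup>+y\<in>cube x \<rho> \<inter> cube z r. ennreal (\<bar>f y - mean_abs (cube x \<rho> \<inter> cube z r) f\<bar> powr p) \<partial>lebesgue)
      = (\<integral>\<^sup>+y\<in>R. ennreal (\<bar>f y - mean_abs R f\<bar> powr p) \<partial>lebesgue)"
      unfolding mean_abs_cong_negligible[OF sub neg Rs \<open>f \<in> borel_measurable lebesgue\<close>]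
      by (intro nn_integral_cong_AE) (use ae sub in \<open>auto elim!: eventually_mono simp: indicator_def\<close>)
    also have "\<dots> \<le> ennreal (4 * L powr p) * emeasure lebesgue R"
      unfolding L_def using M
      by (intro oscillation_Lp_bound[OF f p _ _ R] fat_box_oscillation_le[OF f _ sup]) auto
    also have "\<dots> = ennreal (4 * L powr p * measure lebesgue R)"
      using fat_boxes_lmeasurable[OF R] by (simp add: emeasure_eq_measure2 ennreal_mult)
    also have "\<dots> \<le> ennreal (C powr p * \<rho> ^ CARD('n))"
    proof (rule ennreal_leI)
      have "4 * L powr p * measure lebesgue R \<le> 4 * L powr p * (2 * \<rho>) ^ CARD('n)"
        using mR by (intro mult_left_mono) auto
      also have "\<dots> = (4 * L powr p * 2 ^ CARD('n)) * \<rho> ^ CARD('n)" by (simp add: power_mult_distrib)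
      also have "\<dots> \<le> C powr p * \<rho> ^ CARD('n)" using C \<rho> by (intro mult_right_mono) auto
      finally show "4 * L powr p * measure lebesgue R \<le> C powr p * \<rho> ^ CARD('n)" .
    qed
    finally show "(\<integral>\<^sup>+y\<in>cube x \<rho> \<inter> cube z r. ennreal (\<bar>f y - mean_abs (cube x \<rho> \<inter> cube z r) f\<bar> powr p) \<partial>lebesgue)
      \<le> ennreal (C powr p * \<rho> ^ CARD('n))" .
  qed
  also have "C = 16 * 2 ^ CARD('n) * 2 ^ CARD('n) * 2 powr p * M" by (simp add: C_def L_def)
  finally show ?thesis .
qed

text \<open>With \<open>N\<close> equal to the \<open>L\<^sup>p\<close> size of the oscillation, integrating this inequality gives the bound of an
\<open>L\<^sup>1\<close> mean by an \<open>L\<^sup>p\<close> mean, in place of Hoelder's inequality.\<close>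

lemma le_add_powr_scaled:
  fixes t N p :: real
  assumes "0 \<le> t" "0 < N" "1 < p"
  shows "t \<le> N + N powr (1 - p) * t powr p"
proof (cases "t \<le> N")
  case True
  then show ?thesis by (simp add: add_increasing2)
next
  case False
  then have "t powr (1 - p) * t powr p \<le> N powr (1 - p) * t powr p"
    using assms by (intro mult_right_mono powr_mono2') auto
  then show ?thesis using False assms by (simp flip: powr_add)
qed

lemma barL_sup_1_le:
  fixes f :: "real ^ 'n \<Rightarrow> real"
  assumes [measurable]: "f \<in> borel_measurable lebesgue" "Q \<in> sets lebesgue" and p: "1 < p" and N: "0 < N"
    and sup: "barL_sup p Q f \<le> ennreal (N powr p)"
  shows "barL_sup 1 Q f \<le> ennreal ((2 ^ CARD('n) + 1) * N)"
proof -
  have "0 \<le> (2 ^ CARD('n) + 1) * N" using N by simp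
  then show ?thesis
  proof (subst barL_sup_le_iff, assumption, intro ballI allI impI)
    fix x \<rho> assume x: "x \<in> Q" and \<rho>: "(0::real) < \<rho>"
    define E where "E = cube x \<rho> \<inter> Q"
    have [measurable]: "E \<in> sets lebesgue" unfolding E_def cube_eq_cbox by (intro sets.Int assms(2)) simp
    define m where "m = mean_abs E f"
    have "emeasure lebesgue E \<le> emeasure lebesgue (cube x \<rho>)"
      by (intro emeasure_mono) (auto simp: E_def cube_eq_cbox)
    also have "\<dots> = ennreal (measure lborel (cube x \<rho>))"
      by (simp add: cube_eq_cbox emeasure_eq_measure2)
    also have "measure lborel (cube x \<rho>) = (\<Prod>i\<in>(UNIV::'n set). 2 * \<rho>)"
      unfolding cube_eq_cbox using \<rho> by (subst content_cbox_cart) (auto simp: interval_ne_empty_cart)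
    finally have mE: "emeasure lebesgue E \<le> ennreal ((2 * \<rho>) ^ CARD('n))" by simp
    have I: "(\<integral>\<^sup>+y\<in>E. ennreal (\<bar>f y - m\<bar> powr p) \<partial>lebesgue) \<le> ennreal (N powr p * \<rho> ^ CARD('n))"
      using sup[unfolded barL_sup_le_iff[OF powr_ge_zero]] x \<rho> unfolding m_def E_def by blast
    have "(\<integral>\<^sup>+y\<in>E. ennreal (\<bar>f y - m\<bar> powr 1) \<partial>lebesgue) \<le>
       (\<integral>\<^sup>+y. ennreal N * indicator E y + ennreal (N powr (1 - p)) * (ennreal (\<bar>f y - m\<bar> powr p) * indicator E y) \<partial>lebesgue)"
      using le_add_powr_scaled[OF abs_ge_zero N p] N
      by (intro nn_integral_mono)
         (auto simp: indicator_def simp flip: ennreal_mult ennreal_plus intro!: ennreal_leI)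
    also have "\<dots> = ennreal N * emeasure lebesgue E
        + ennreal (N powr (1 - p)) * (\<integral>\<^sup>+y\<in>E. ennreal (\<bar>f y - m\<bar> powr p) \<partial>lebesgue)"
      by (simp add: nn_integral_add nn_integral_cmult nn_integral_cmult_indicator)
    also have "\<dots> \<le> ennreal N * ennreal ((2 * \<rho>) ^ CARD('n)) + ennreal (N powr (1 - p)) * ennreal (N powr p * \<rho> ^ CARD('n))"
      by (intro add_mono mult_left_mono mE I) auto
    also have "\<dots> = ennreal (N * (2 * \<rho>) ^ CARD('n) + N powr (1 - p) * (N powr p * \<rho> ^ CARD('n)))"
      using N \<rho> by (simp flip: ennreal_mult ennreal_plus)
    also have "N powr (1 - p) * (N powr p * \<rho> ^ CARD('n)) = N * \<rho> ^ CARD('n)"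
      using N by (simp add: mult.assoc[symmetric] flip: powr_add)
    also have "N * (2 * \<rho>) ^ CARD('n) + N * \<rho> ^ CARD('n) = (2 ^ CARD('n) + 1) * N * \<rho> ^ CARD('n)"
      by (simp add: power_mult_distrib algebra_simps)
    finally show "(\<integral>\<^sup>+y\<in>cube x \<rho> \<inter> Q. ennreal (\<bar>f y - mean_abs (cube x \<rho> \<inter> Q) f\<bar> powr 1) \<partial>lebesgue)
      \<le> ennreal ((2 ^ CARD('n) + 1) * N * \<rho> ^ CARD('n))" by (simp add: m_def E_def)
  qed
qed

text \<open>The bounds on the suprema are available for positive \<open>N\<close> only, while a norm may vanish; so \<open>N\<close> is let
decrease to the norm.\<close>

lemma enn2real_powr_le:
  fixes S S' :: ennreal and q q' C :: real
  assumes q: "0 < q" and q': "0 < q'" and C: "0 < C" and S: "S < \<infinity>"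
    and bound: "\<And>N. 0 < N \<Longrightarrow> S \<le> ennreal (N powr q) \<Longrightarrow> S' \<le> ennreal ((C * N) powr q')"
  shows "S' < \<infinity>" "enn2real S' powr (1 / q') \<le> C * enn2real S powr (1 / q)"
proof -
  define a where "a = enn2real S powr (1 / q)"
  have a: "0 \<le> a" by (simp add: a_def)
  have Sa: "S = ennreal (a powr q)" using S q by (simp add: a_def powr_powr)
  have bd: "S' \<le> ennreal ((C * N) powr q')" if "a < N" for N
    using that a q by (intro bound) (auto simp: Sa intro!: ennreal_leI powr_mono2)
  show "S' < \<infinity>" using bd[of "a + 1"] by (simp add: le_less_trans[OF _ ennreal_less_top])
  show "enn2real S' powr (1 / q') \<le> C * enn2real S powr (1 / q)"
  proof (rule field_le_epsilon)
    fix e :: real assume e: "0 < e"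
    define N where "N = a + e / C"
    have N: "a < N" using e C by (simp add: N_def)
    have "enn2real S' \<le> (C * N) powr q'" using bd[OF N] by (intro enn2real_leI) auto
    then have "enn2real S' powr (1 / q') \<le> ((C * N) powr q') powr (1 / q')"
      using q' by (intro powr_mono2) auto
    also have "\<dots> = C * N" using q' N a C by (simp add: powr_powr)
    also have "\<dots> = C * a + e" using C by (simp add: N_def field_simps)
    finally show "enn2real S' powr (1 / q') \<le> C * enn2real S powr (1 / q) + e" by (simp add: a_def)
  qed
qed

text \<open>Extending \<open>f\<close> by zero makes it integrable on the whole space, as the
estimates above assume, without changing its oscillations inside \<open>Q\<close>.\<close>

lemma barL_sup_restrict:
  "barL_sup q Q (\<lambda>x. indicator Q x *\<^sub>R f x) = barL_sup q Q f"
proof -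
  have "mean_abs (cube x \<rho> \<inter> Q) (\<lambda>x. indicator Q x *\<^sub>R f x) = mean_abs (cube x \<rho> \<inter> Q) f" for x \<rho>
    unfolding mean_abs_def set_lebesgue_integral_def
    by (intro arg_cong2[where f="(*)"] refl Bochner_Integration.integral_cong) (auto simp: indicator_def)
  moreover have "(\<integral>\<^sup>+x\<in>cube z \<rho> \<inter> Q. ennreal (\<bar>indicator Q x *\<^sub>R f x - m\<bar> powr q) \<partial>lebesgue)
      = (\<integral>\<^sup>+x\<in>cube z \<rho> \<inter> Q. ennreal (\<bar>f x - m\<bar> powr q) \<partial>lebesgue)" for z \<rho> m
    by (rule nn_integral_cong) (auto simp: indicator_def)
  ultimately show ?thesis unfolding barL_sup_def by simp
qed

theorem theorem3p3:
  fixes p :: real and Q\<^sub>0 :: "(real ^ 'n) set"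
  assumes "1 < p" and "is_cube Q\<^sub>0"
  shows "barL p Q\<^sub>0 = barL 1 Q\<^sub>0 \<and>
    (\<exists>C\<ge>1. \<forall>f\<in>barL 1 Q\<^sub>0.
       inverse C * barL_norm 1 Q\<^sub>0 f \<le> barL_norm p Q\<^sub>0 f \<and>
       barL_norm p Q\<^sub>0 f \<le> C * barL_norm 1 Q\<^sub>0 f)"
proof -
  obtain z r where r: "0 < r" and Q: "Q\<^sub>0 = cube z r" using assms(2) unfolding is_cube_def by blast
  have Qs: "Q\<^sub>0 \<in> sets lebesgue" by (simp add: Q cube_eq_cbox)
  define C :: real where "C = 16 * 2 ^ CARD('n) * 2 ^ CARD('n) * 2 powr p"
  define C' :: real where "C' = 2 ^ CARD('n) + 1"
  have C': "0 < C'" by (simp add: C'_def add_pos_pos)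
  have "1 \<le> 2 powr p" using assms(1) by (intro ge_one_powr_ge_zero) auto
  moreover have n: "(1::real) \<le> 2 ^ CARD('n)" by (rule one_le_power) simp
  have "1 * 1 \<le> 2 ^ CARD('n) * (2 ^ CARD('n) :: real)" using n by (intro mult_mono) auto
  then have "1 \<le> 16 * 2 ^ CARD('n) * (2 ^ CARD('n) :: real)" unfolding mult.assoc by linarith
  ultimately have "1 * 1 \<le> (16 * 2 ^ CARD('n) * 2 ^ CARD('n)) * 2 powr p"
    by (intro mult_mono) auto
  then have C: "1 \<le> C" by (simp add: C_def)
  then have C0: "0 < C" by linarith
  have p0: "0 < p" using assms(1) by linarith
  have up: "barL_sup p Q\<^sub>0 f < \<infinity>" "barL_norm p Q\<^sub>0 f \<le> C * barL_norm 1 Q\<^sub>0 f" if f: "f \<in> barL 1 Q\<^sub>0" for f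
  proof -
    define g where "g x = indicator Q\<^sub>0 x *\<^sub>R f x" for x
    have g: "integrable lebesgue g" using f unfolding barL_def g_def set_integrable_def by simp
    have fin: "barL_sup 1 Q\<^sub>0 f < \<infinity>" using f by (simp add: barL_def)
    have "barL_sup p Q\<^sub>0 f \<le> ennreal ((C * N) powr p)" if "0 < N" "barL_sup 1 Q\<^sub>0 f \<le> ennreal (N powr 1)" for N
      using barL_sup_p_le[OF g assms(1) r that(1), of z] that
      unfolding g_def barL_sup_restrict Q[symmetric] C_def by simp
    note cmp = enn2real_powr_le[OF zero_less_one p0 C0 fin this]
    show "barL_sup p Q\<^sub>0 f < \<infinity>" by (rule cmp(1))
    show "barL_norm p Q\<^sub>0 f \<le> C * barL_norm 1 Q\<^sub>0 f" unfolding barL_norm_def by (rule cmp(2))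
  qed
  have down: "barL_sup 1 Q\<^sub>0 f < \<infinity>" "barL_norm 1 Q\<^sub>0 f \<le> C' * barL_norm p Q\<^sub>0 f" if f: "f \<in> barL p Q\<^sub>0" for f
  proof -
    define g where "g x = indicator Q\<^sub>0 x *\<^sub>R f x" for x
    have "integrable lebesgue g" using f unfolding barL_def g_def set_integrable_def by simp
    then have g: "g \<in> borel_measurable lebesgue" by simp
    have fin: "barL_sup p Q\<^sub>0 f < \<infinity>" using f by (simp add: barL_def)
    have "barL_sup 1 Q\<^sub>0 f \<le> ennreal ((C' * N) powr 1)" if "0 < N" "barL_sup p Q\<^sub>0 f \<le> ennreal (N powr p)" for N
      using barL_sup_1_le[OF g Qs assms(1) that(1)] that C'
      unfolding g_def barL_sup_restrict C'_def by simp
    note cmp = enn2real_powr_le[OF p0 zero_less_one C' fin this]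
    show "barL_sup 1 Q\<^sub>0 f < \<infinity>" by (rule cmp(1))
    show "barL_norm 1 Q\<^sub>0 f \<le> C' * barL_norm p Q\<^sub>0 f" unfolding barL_norm_def by (rule cmp(2))
  qed
  have eq: "barL p Q\<^sub>0 = barL 1 Q\<^sub>0" using up(1) down(1) by (auto simp: barL_def)
  define D where "D = max C C'"
  have "inverse D * barL_norm 1 Q\<^sub>0 f \<le> barL_norm p Q\<^sub>0 f \<and> barL_norm p Q\<^sub>0 f \<le> D * barL_norm 1 Q\<^sub>0 f"
    if "f \<in> barL 1 Q\<^sub>0" for f
  proof
    have D: "0 < D" using C by (simp add: D_def)
    have pos: "0 \<le> barL_norm q Q\<^sub>0 f" for q by (simp add: barL_norm_def)
    have "barL_norm 1 Q\<^sub>0 f \<le> C' * barL_norm p Q\<^sub>0 f" using down(2) that eq by blast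
    also have "\<dots> \<le> D * barL_norm p Q\<^sub>0 f" by (intro mult_right_mono pos) (simp add: D_def)
    finally show "inverse D * barL_norm 1 Q\<^sub>0 f \<le> barL_norm p Q\<^sub>0 f" using D by (simp add: field_simps)
    have "barL_norm p Q\<^sub>0 f \<le> C * barL_norm 1 Q\<^sub>0 f" using up(2) that by blast
    also have "\<dots> \<le> D * barL_norm 1 Q\<^sub>0 f" by (intro mult_right_mono pos) (simp add: D_def)
    finally show "barL_norm p Q\<^sub>0 f \<le> D * barL_norm 1 Q\<^sub>0 f" .
  qed
  moreover have "1 \<le> D" using C by (simp add: D_def)
  ultimately show ?thesis using eq by blast
qed

end
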